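(* Let $n$ be a positive integer and let $\lambda>1$ be a real number. If $\mathcal{F}\subset 2^{[n]}$ is a family that contains no two different members $A,B\in\mathcal{F}$ with $A\subset B$ and $\lambda\cdot|A|\le|B|$, then $|\mathcal{F}|\le T(n,\lambda)$. Moreover, this bound is sharp: for every positive integer $n$ and real $\lambda>1$ there exists a family $\mathcal{F}\subset 2^{[n]}$ satisfying this condition with $|\mathcal{F}|=T(n,\lambda)$.
   Context: $[n]=\{1,2,\dots,n\}$ and $2^{[n]}$ is the family of all subsets of $[n]$. For an integer $1\le k\le n$ and a real number $\lambda>1$ define $$t(n,k,\lambda)=\sum_{k\le i<\lambda k}\binom{n}{i},$$ where the sum is over integers $i$ and $\binom{n}{i}=0$ for $i>n$, and define $$T(n,\lambda)=\max_{1\le k\le n}t(n,k,\lambda),$$ the maximum being over integers $k$. *)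

theory Defs
  imports Complex_Main
begin

text \<open>The real parameter is called \<open>r\<close>. No upper cut-off at \<open>n\<close> is needed in the sum: the
  index set is finite, and \<open>n choose i = 0\<close> for \<open>i > n\<close>.\<close>

definition t :: "nat \<Rightarrow> nat \<Rightarrow> real \<Rightarrow> nat" where
  "t n k r = (\<Sum>i \<in> {i. k \<le> i \<and> real i < r * real k}. n choose i)"

definition T :: "nat \<Rightarrow> real \<Rightarrow> nat" where
  "T n r = Max ((\<lambda>k. t n k r) ` {1..n})"

text \<open>For \<open>A = {}\<close> the size condition holds for every \<open>B\<close>; so a family with this property that
  contains the empty set has no other member.\<close>

definition avoids_ratio_pairs :: "real \<Rightarrow> nat set set \<Rightarrow> bool" where
  "avoids_ratio_pairs r F \<longleftrightarrow>
     \<not> (\<exists>A\<in>F. \<exists>B\<in>F. A \<noteq> B \<and> A \<subseteq> B \<and> r * real (card A) \<le> real (card B))"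

end

theory Submission
  imports Defs "HOL-Combinatorics.Permutations"
begin

text \<open>Give a set \<open>A\<close> the weight \<open>n choose card A\<close>. A uniformly random maximal chain of \<open>Pow {1..n}\<close>
  contains \<open>A\<close> with probability \<open>1 / (n choose card A)\<close>, so the expected weight of the members of
  \<open>F\<close> on the chain is \<open>card F\<close>. On the other hand, if \<open>k > 0\<close> is the least size of a member of \<open>F\<close>
  on a given chain, then all sizes lie in \<open>[k, r k)\<close>, so this weight is at most \<open>t n k r\<close>. Maximal
  chains are represented by the permutations \<open>p\<close> of \<open>{1..n}\<close>, through the sets \<open>p ` {1..i}\<close>.\<close>

lemma ex_permutes_image_eq:
  assumes "finite S" "A \<subseteq> S" "B \<subseteq> S" "card A = card B"
  obtains q where "q permutes S" "q ` A = B"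
proof -
  have fin: "finite A" "finite B"
    using assms finite_subset by auto
  obtain f where f: "bij_betw f A B"
    using finite_same_card_bij[OF fin assms(4)] by auto
  have "card (S - A) = card (S - B)"
    using assms fin by (simp add: card_Diff_subset)
  then obtain g where g: "bij_betw g (S - A) (S - B)"
    using finite_same_card_bij assms(1) by (metis finite_Diff)
  \<comment> \<open>Bijections \<open>A\<close> to \<open>B\<close> and \<open>S - A\<close> to
    \<open>S - B\<close> are glued; the identity outside \<open>S\<close> is what
    \<open>permutes\<close> demands.\<close>
  define q where "q x = (if x \<in> A then f x else if x \<in> S then g x else x)" for x
  have qA: "bij_betw q A B"
    using f by (rule bij_betw_cong[THEN iffD1, rotated]) (simp add: q_def)
  have "bij_betw q (S - A) (S - B)"
    using g by (rule bij_betw_cong[THEN iffD1, rotated]) (simp add: q_def)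
  then have "bij_betw q (A \<union> (S - A)) (B \<union> (S - B))"
    by (intro bij_betw_combine qA) auto
  then have "bij_betw q S S"
    using assms(2,3) by (simp add: Un_absorb1)
  then have "q permutes S"
    using assms(2) by (intro bij_imp_permutes) (auto simp: q_def)
  then show ?thesis
    using that qA by (simp add: bij_betw_def)
qed

text \<open>The permutations of \<open>S\<close> are partitioned by the image of \<open>K\<close>, a
  subset of size \<open>card K\<close>. By symmetry all classes are equally large. This is the
  probability that \<open>A\<close> lies on a random chain, with denominators cleared.\<close>

lemma card_permutes_image_eq:
  assumes "finite S" "K \<subseteq> S" "A \<subseteq> S" "card A = card K"
  shows "card {p. p permutes S \<and> p ` K = A} * (card S choose card K) = fact (card S)"
proof -
  let ?P = "\<lambda>B. {p. p permutes S \<and> p ` K = B}"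
  let ?C = "{B. B \<subseteq> S \<and> card B = card K}"
  have le: "card (?P B) \<le> card (?P C)" if B: "B \<in> ?C" and C: "C \<in> ?C" for B C
  proof -
    obtain q where q: "q permutes S" "q ` B = C"
      using ex_permutes_image_eq[OF assms(1), of B C] B C by auto
    \<comment> \<open>Composition with \<open>q\<close> carries the class of \<open>B\<close>
      injectively into that of \<open>C\<close>; exchanging the roles of \<open>B\<close> and
      \<open>C\<close> later gives equality.\<close>
    have "inj_on ((\<circ>) q) (?P B)"
      using permutes_inj[OF q(1)] by (auto simp: inj_on_def fun_eq_iff dest: injD)
    moreover have "(\<circ>) q ` ?P B \<subseteq> ?P C"
      using q by (auto intro: permutes_compose simp: image_comp[symmetric])
    moreover have "finite (?P C)"
      using finite_permutations[OF assms(1)] by (rule rev_finite_subset) auto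
    ultimately show ?thesis
      by (rule card_inj_on_le)
  qed
  have "A \<in> ?C"
    using assms by auto
  then have eq: "card (?P B) = card (?P A)" if "B \<in> ?C" for B
    using le that by (metis (lifting) order_antisym)
  have "{p. p permutes S} = (\<Union>B\<in>?C. ?P B)"
    using assms(2) by (auto simp: permutes_in_image subset_iff
        intro!: card_image inj_on_subset[OF permutes_inj])
  then have "fact (card S) = card (\<Union>B\<in>?C. ?P B)"
    using card_permutations[OF refl assms(1)] by simp
  also have "\<dots> = (\<Sum>B\<in>?C. card (?P B))"
    using assms(1) finite_permutations[OF assms(1)]
    by (intro card_UN_disjoint) (auto intro: rev_finite_subset)
  also have "\<dots> = (\<Sum>B\<in>?C. card (?P A))"
    using eq by (rule sum.cong[OF refl])
  also have "\<dots> = card (?P A) * (card S choose card K)"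
    using n_subsets[OF assms(1)] by simp
  finally show ?thesis
    by simp
qed

lemma finite_t_index: "finite {i. k \<le> i \<and> real i < r * real k}"
proof (rule finite_subset)
  show "{i. k \<le> i \<and> real i < r * real k} \<subseteq> {..nat \<lceil>r * real k\<rceil>}"
    by (auto simp: le_nat_iff) linarith
qed simp

lemma t_le_T: "1 \<le> k \<Longrightarrow> k \<le> n \<Longrightarrow> t n k r \<le> T n r"
  unfolding T_def by (intro Max_ge) auto

text \<open>Serves the chains on which the empty set, of weight 1, is the only member of
  \<open>F\<close>.\<close>

lemma T_pos:
  assumes "n \<ge> 1" "r > 1"
  shows "1 \<le> T n r"
proof -
  have "n choose 1 \<le> t n 1 r"
    unfolding t_def using assms(2) finite_t_index[of 1 r] by (intro member_le_sum) auto
  also have "\<dots> \<le> T n r"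
    using assms by (intro t_le_T) auto
  finally show ?thesis
    using assms by simp
qed

lemma chain_weight_le_T:
  assumes n: "n \<ge> 1" and r: "r > 1"
    and F: "F \<subseteq> Pow {1..n}" and av: "avoids_ratio_pairs r F"
    and p: "p permutes {1..n}"
  shows "(\<Sum>A\<in>{A\<in>F. p ` {1..card A} = A}. n choose card A) \<le> T n r"
proof -
  let ?G = "{A\<in>F. p ` {1..card A} = A}"
  define I where "I = card ` ?G"
  have "finite ?G"
    using F by (intro finite_subset[of ?G "Pow {1..n}"]) auto
  then have finI: "finite I"
    by (simp add: I_def)
  have "inj_on card ?G"
    by (rule inj_on_inverseI[where g = "\<lambda>i. p ` {1..i}"]) simp
  then have sum_eq: "(\<Sum>A\<in>?G. n choose card A) = (\<Sum>i\<in>I. n choose i)"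
    by (simp add: I_def sum.reindex)
  have window: "real j < r * real i" if ij: "i \<in> I" "j \<in> I" "i < j" for i j
  proof -
    obtain A where A: "A \<in> F" "p ` {1..card A} = A" "card A = i"
      using ij(1) by (auto simp: I_def)
    obtain B where B: "B \<in> F" "p ` {1..card B} = B" "card B = j"
      using ij(2) by (auto simp: I_def)
    have "p ` {1..card A} \<subseteq> p ` {1..card B}"
      using A(3) B(3) ij(3) by (intro image_mono) simp
    then have "A \<subseteq> B"
      unfolding A(2) B(2) .
    moreover have "A \<noteq> B"
      using A(3) B(3) ij(3) by blast
    ultimately have "\<not> r * real (card A) \<le> real (card B)"
      using av A(1) B(1) unfolding avoids_ratio_pairs_def by blast
    then show ?thesis
      using A(3) B(3) by simp
  qed
  show ?thesis
  proof (cases "I = {}")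
    case True
    then show ?thesis
      using sum_eq by simp
  next
    case False
    define k where "k = Min I"
    have k: "k \<in> I" "\<And>i. i \<in> I \<Longrightarrow> k \<le> i"
      using finI False by (auto simp: k_def)
    show ?thesis
    proof (cases "k = 0")
      case True
      \<comment> \<open>A further size \<open>j > 0\<close> would satisfy
        \<open>real j < r * 0\<close> by \<open>window\<close>. The value \<open>k = 0\<close> is
        outside the range of the maximum in \<open>T\<close>, hence the separate bound.\<close>
      then have "I = {0}"
        using k window[of 0] by fastforce
      then show ?thesis
        using sum_eq T_pos[OF n r] by simp
    next
      case False
      have "k \<le> n"
      proof -
        obtain A where "A \<in> F" "card A = k"
          using k(1) by (auto simp: I_def)
        then show ?thesis
          using F card_mono[of "{1..n}" A] by auto
      qed
      have "I \<subseteq> {i. k \<le> i \<and> real i < r * real k}"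
      proof
        fix i
        assume i: "i \<in> I"
        \<comment> \<open>\<open>window\<close> covers only \<open>i > k\<close>; for
          \<open>i = k\<close> the inequality comes from \<open>r > 1\<close> and
          \<open>k > 0\<close>.\<close>
        have "real i < r * real k"
          using window[OF k(1) i] k(2)[OF i] r False by (cases "i = k") simp_all
        then show "i \<in> {i. k \<le> i \<and> real i < r * real k}"
          using k(2)[OF i] by simp
      qed
      then have "(\<Sum>i\<in>I. n choose i) \<le> t n k r"
        unfolding t_def by (intro sum_mono2 finite_t_index) auto
      also have "\<dots> \<le> T n r"
        using False \<open>k \<le> n\<close> by (intro t_le_T) auto
      finally show ?thesis
        using sum_eq by simp
    qed
  qed
qed

text \<open>Double counting of the pairs of a set \<open>A\<close> in \<open>F\<close> and a
  permutation \<open>p\<close> whose chain contains \<open>A\<close>, weighted by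
  \<open>n choose card A\<close>: each \<open>A\<close> contributes exactly \<open>fact n\<close>,
  each \<open>p\<close> at most \<open>T n r\<close>.\<close>

lemma card_le_T:
  assumes "n \<ge> 1" "r > 1" "F \<subseteq> Pow {1..n}" "avoids_ratio_pairs r F"
  shows "card F \<le> T n r"
proof -
  let ?P = "{p. p permutes {1..n}}"
  have finF: "finite F"
    using assms(3) finite_subset by blast
  have finP: "finite ?P"
    by (simp add: finite_permutations)
  have "fact n = card {p \<in> ?P. p ` {1..card A} = A} * (n choose card A)" if "A \<in> F" for A
  proof -
    have "A \<subseteq> {1..n}"
      using that assms(3) by auto
    then show ?thesis
      using card_permutes_image_eq[of "{1..n}" "{1..card A}" A] card_mono[of "{1..n}" A] by simp
  qed
  then have "(\<Sum>A\<in>F. fact n) = (\<Sum>A\<in>F. \<Sum>p\<in>{p \<in> ?P. p ` {1..card A} = A}. n choose card A)"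
    by (intro sum.cong) simp_all
  then have "card F * fact n = (\<Sum>A\<in>F. \<Sum>p\<in>{p \<in> ?P. p ` {1..card A} = A}. n choose card A)"
    by simp
  also have "\<dots> = (\<Sum>p\<in>?P. \<Sum>A\<in>{A \<in> F. p ` {1..card A} = A}. n choose card A)"
    by (rule sum.swap_restrict[OF finF finP])
  also have "\<dots> \<le> (\<Sum>p\<in>?P. T n r)"
    using chain_weight_le_T[OF assms] by (intro sum_mono) simp
  also have "\<dots> = T n r * fact n"
    using card_permutations[of "{1..n}" n] by simp
  finally show ?thesis
    by simp
qed

text \<open>The witness consists of all full levels in a window \<open>[k, r * k)\<close> for a
  maximising \<open>k\<close>. Two sizes in such a window never differ by a factor of
  \<open>r\<close> or more. Levels above \<open>n\<close> are empty, in agreement with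
  \<open>n choose i = 0\<close>.\<close>

lemma ex_card_eq_T:
  assumes "n \<ge> 1" "r > 1"
  shows "\<exists>F. F \<subseteq> Pow {1..n} \<and> avoids_ratio_pairs r F \<and> card F = T n r"
proof -
  have "T n r \<in> (\<lambda>k. t n k r) ` {1..n}"
    unfolding T_def using assms by (intro Max_in) auto
  then obtain k where k: "1 \<le> k" "T n r = t n k r"
    by auto
  let ?I = "{i. k \<le> i \<and> real i < r * real k}"
  let ?L = "\<lambda>i. {A. A \<subseteq> {1..n} \<and> card A = i}"
  define F where "F = (\<Union>i\<in>?I. ?L i)"
  have "card F = (\<Sum>i\<in>?I. card (?L i))"
    unfolding F_def using finite_t_index by (intro card_UN_disjoint) auto
  also have "\<dots> = T n r"
    using n_subsets[of "{1..n}"] by (simp add: k t_def)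
  finally have "card F = T n r" .
  moreover have "avoids_ratio_pairs r F"
  proof -
    have "real (card B) < r * real (card A)" if "A \<in> F" "B \<in> F" for A B
    proof -
      have "real k \<le> real (card A)" "real (card B) < r * real k"
        using that by (auto simp: F_def)
      moreover from this have "r * real k \<le> r * real (card A)"
        using assms(2) by (intro mult_left_mono) auto
      ultimately show ?thesis
        by linarith
    qed
    then show ?thesis
      unfolding avoids_ratio_pairs_def by (meson not_le)
  qed
  ultimately show ?thesis
    by (intro exI[of _ F]) (auto simp: F_def)
qed

theorem theorem4p4:
  fixes n :: nat and r :: real
  assumes "n \<ge> 1" and "r > 1"
  shows "(\<forall>F. F \<subseteq> Pow {1..n} \<and> avoids_ratio_pairs r F \<longrightarrow> card F \<le> T n r) \<and>
         (\<exists>F. F \<subseteq> Pow {1..n} \<and> avoids_ratio_pairs r F \<and> card F = T n r)"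
  using card_le_T[OF assms] ex_card_eq_T[OF assms] by blast

end
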